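(* Let $T>0$, $\mathbb{T}=[0,T]$, $H\in(0,1)$, let $B$ be a standard Brownian motion on $[0,\infty)$, and let $B_H$ be the fractional Brownian motion with Hurst index $H$ given by $B_H(t)=\int_0^t k_H(t,\tau)\,dB(\tau)$. Let $\{q(i,\cdot)\}_{i=0}^\infty$ be an orthonormal basis of the real space $L_2(\mathbb{T})$. Let $\mathcal{B}^H$ be the spectral characteristic of $B_H$, let $K^H$ be the spectral characteristic of the linear operator $\mathcal{K}_H$, i.e. the two-dimensional spectral characteristic of the function $k_H$, and let $\mathcal{V}$ be the spectral characteristic of the Gaussian white noise associated with $B$, all defined relative to $\{q(i,\cdot)\}_{i=0}^\infty$. Then $$\mathcal{B}^H=K^H\mathcal{V},$$ that is, for every $i=0,1,2,\dots$, $$\mathcal{B}^H_i=\sum_{j=0}^\infty K^H_{ij}\mathcal{V}_j ,$$ where the series converges in mean square and the equality holds almost surely.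
   Context: All random objects are defined on a complete probability space $(\Omega,\mathcal{F},\mathrm{P})$. The fractional Brownian motion with Hurst index $H\in(0,1)$ is a centered Gaussian process $B_H$ with $B_H(0)=0$ and covariance $\mathrm{E}B_H(t)B_H(\tau)=R_H(t,\tau)=\frac12\left(t^{2H}+\tau^{2H}-|t-\tau|^{2H}\right)$ for $t,\tau\ge 0$. It is represented as $B_H(t)=\int_0^t k_H(t,\tau)\,dB(\tau)$ (Wiener integral), where $$k_H(t,\tau)=\frac{a_H}{\Gamma(H+1/2)}\,(t-\tau)^{H-1/2}\;{}_2F_1\!\left(\tfrac12-H,\;H-\tfrac12;\;H+\tfrac12;\;1-\tfrac{t}{\tau}\right)\ \text{ for } t>\tau>0,\qquad k_H(t,\tau)=0\ \text{ for } t\le\tau,$$ $$a_H=\sqrt{\frac{2H\,\Gamma(H+1/2)\,\Gamma(3/2-H)}{\Gamma(2-2H)}},$$ and ${}_2F_1$ is the Gauss hypergeometric function (analytically continued to $(-\infty,0)$). The function $k_H$ satisfies $R_H(t,\tau)=\int_0^{\min\{t,\tau\}}k_H(t,\theta)k_H(\tau,\theta)\,d\theta$, and it is the kernel of the operator $\mathcal{K}_H\varphi(t)=\int_0^t k_H(t,\tau)\varphi(\tau)\,d\tau$ on $L_2(\mathbb{T})$. Spectral characteristics relative to $\{q(i,\cdot)\}_{i=0}^\infty$ (indices $i,j=0,1,2,\dots$): the spectral characteristic of the process $B_H$ (whose paths lie in $L_2(\mathbb{T})$ almost surely) is the infinite random column $\mathcal{B}^H$ with $\mathcal{B}^H_i=\int_{\mathbb{T}}q(i,t)B_H(t)\,dt$;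 the two-dimensional spectral characteristic of $k_H$ (restricted to $\mathbb{T}^2$), which is also the spectral characteristic of $\mathcal{K}_H$, is the infinite matrix $K^H$ with $K^H_{ij}=\int_{\mathbb{T}}\int_{\mathbb{T}}q(i,t)q(j,\tau)k_H(t,\tau)\,d\tau\,dt=(q(i,\cdot),\mathcal{K}_Hq(j,\cdot))_{L_2(\mathbb{T})}$; the spectral characteristic of the Gaussian white noise associated with $B$ is the infinite random column $\mathcal{V}$ with $\mathcal{V}_i=\int_{\mathbb{T}}q(i,t)\,dB(t)$. *)

theory Defs
  imports "HOL-Probability.Probability" "HOL-Complex_Analysis.Complex_Analysis"
begin

section \<open>Square-integrable functions and orthonormal bases\<close>

definition square_integrable :: "'a measure \<Rightarrow> ('a \<Rightarrow> real) \<Rightarrow> bool" where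
  "square_integrable M f \<longleftrightarrow> f \<in> borel_measurable M \<and> integrable M (\<lambda>x. (f x)\<^sup>2)"

text \<open>
  \<open>L\<^sub>2\<close> is represented by honest functions rather than by almost-everywhere classes.
\<close>

definition orthonormal_basis_L2 :: "'a measure \<Rightarrow> (nat \<Rightarrow> 'a \<Rightarrow> real) \<Rightarrow> bool" where
  "orthonormal_basis_L2 M q \<longleftrightarrow>
     (\<forall>i. square_integrable M (q i)) \<and>
     (\<forall>i j. (LINT x|M. q i x * q j x) = (if i = j then 1 else 0)) \<and>
     (\<forall>f. square_integrable M f \<longrightarrow>
        (\<lambda>n. LINT x|M. (f x - (\<Sum>j<n. (LINT y|M. q j y * f y) * q j x))\<^sup>2) \<longlonglongrightarrow> 0)"

definition sums_in_mean_square :: "'a measure \<Rightarrow> (nat \<Rightarrow> 'a \<Rightarrow> real) \<Rightarrow> ('a \<Rightarrow> real) \<Rightarrow> bool" where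
  "sums_in_mean_square M Y S \<longleftrightarrow>
     (\<forall>j. square_integrable M (Y j)) \<and> square_integrable M S \<and>
     (\<lambda>n. LINT \<omega>|M. (S \<omega> - (\<Sum>j<n. Y j \<omega>))\<^sup>2) \<longlonglongrightarrow> 0"


section \<open>Brownian motion and the Wiener integral\<close>

locale brownian_motion = prob_space M for M :: "'a measure" +
  fixes B :: "real \<Rightarrow> 'a \<Rightarrow> real"
  assumes random_variable: "\<And>t. 0 \<le> t \<Longrightarrow> B t \<in> borel_measurable M"
    and starts_at_0: "AE \<omega> in M. B 0 \<omega> = 0"
    and independent_increments:
      "\<And>\<tau> n. mono \<tau> \<Longrightarrow> 0 \<le> \<tau> 0 \<Longrightarrow>
         indep_vars (\<lambda>_. borel) (\<lambda>(k::nat) \<omega>. B (\<tau> (Suc k)) \<omega> - B (\<tau> k) \<omega>) {..<n}"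
    and normal_increments:
      "\<And>s t. 0 \<le> s \<Longrightarrow> s < t \<Longrightarrow>
         distributed M lborel (\<lambda>\<omega>. B t \<omega> - B s \<omega>) (normal_density 0 (sqrt (t - s)))"
    and continuous_paths: "AE \<omega> in M. continuous_on {0..} (\<lambda>t. B t \<omega>)"

text \<open>
  A step function \<open>\<Sum>k. c\<^sub>k 1\<^bsub>(u\<^sub>k, v\<^sub>k]\<^esub>\<close> is given by the list of the triples
  \<open>(c\<^sub>k, u\<^sub>k, v\<^sub>k)\<close>.
\<close>

definition steps_within :: "real \<Rightarrow> real \<Rightarrow> (real \<times> real \<times> real) list \<Rightarrow> bool" where
  "steps_within a b xs \<longleftrightarrow> (\<forall>(c, u, v)\<in>set xs. a \<le> u \<and> u \<le> v \<and> v \<le> b)"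

definition step_function :: "(real \<times> real \<times> real) list \<Rightarrow> real \<Rightarrow> real" where
  "step_function xs x = (\<Sum>(c, u, v)\<leftarrow>xs. c * indicator {u<..v} x)"

definition step_integral ::
  "(real \<Rightarrow> 'a \<Rightarrow> real) \<Rightarrow> (real \<times> real \<times> real) list \<Rightarrow> 'a \<Rightarrow> real" where
  "step_integral B xs \<omega> = (\<Sum>(c, u, v)\<leftarrow>xs. c * (B v \<omega> - B u \<omega>))"

text \<open>
  \<open>has_wiener_integral M B a b f Y\<close>: the random variable \<open>Y\<close> is (a version of)
  \<open>\<integral>\<^sub>a\<^sup>b f(x) dB(x)\<close>, the mean-square limit of the integrals of step functions converging
  to \<open>f\<close> in \<open>L\<^sub>2([a,b])\<close>. It is determined by \<open>f\<close> up to almost sure equality.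
\<close>

definition has_wiener_integral ::
  "'a measure \<Rightarrow> (real \<Rightarrow> 'a \<Rightarrow> real) \<Rightarrow> real \<Rightarrow> real \<Rightarrow> (real \<Rightarrow> real) \<Rightarrow> ('a \<Rightarrow> real) \<Rightarrow> bool" where
  "has_wiener_integral M B a b f Y \<longleftrightarrow>
     square_integrable (lebesgue_on {a..b}) f \<and> square_integrable M Y \<and>
     (\<exists>s. (\<forall>n. steps_within a b (s n)) \<and>
        (\<lambda>n. LINT x|lebesgue_on {a..b}. (f x - step_function (s n) x)\<^sup>2) \<longlonglongrightarrow> 0 \<and>
        (\<lambda>n. LINT \<omega>|M. (Y \<omega> - step_integral B (s n) \<omega>)\<^sup>2) \<longlonglongrightarrow> 0)"


section \<open>The Gauss hypergeometric function\<close>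

definition cut_plane :: "complex set" where
  "cut_plane = - {z. Im z = 0 \<and> 1 \<le> Re z}"

text \<open>
  The principal branch: the analytic continuation of the hypergeometric series from the unit
  disc to the plane cut along \<open>[1,\<infinity>)\<close>. Values on the cut are unspecified.
\<close>

definition hypergeo_2F1 :: "complex \<Rightarrow> complex \<Rightarrow> complex \<Rightarrow> complex \<Rightarrow> complex" where
  "hypergeo_2F1 a b c =
     (SOME F. F holomorphic_on cut_plane \<and>
        (\<forall>z\<in>ball 0 1. F z = eval_fps (fps_hypergeo [a, b] [c] 1) z))"

lemma hypergeo_2F1_unique:
  assumes F: "F holomorphic_on cut_plane"
    and F_series: "\<And>z. z \<in> ball 0 1 \<Longrightarrow> F z = eval_fps (fps_hypergeo [a, b] [c] 1) z"
    and z: "z \<in> cut_plane"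
  shows "hypergeo_2F1 a b c z = F z"
proof -
  let ?G = "hypergeo_2F1 a b c"
  have G: "?G holomorphic_on cut_plane \<and>
      (\<forall>z\<in>ball 0 1. ?G z = eval_fps (fps_hypergeo [a, b] [c] 1) z)"
    unfolding hypergeo_2F1_def
    by (rule someI[where P = "\<lambda>F. F holomorphic_on cut_plane \<and>
      (\<forall>z\<in>ball 0 1. F z = eval_fps (fps_hypergeo [a, b] [c] 1) z)" and x = F])
       (use F F_series in auto)
  have "{z. Im z = 0 \<and> 1 \<le> Re z} = {z. Im z = 0} \<inter> {z. 1 \<le> Re z}"
    by auto
  then have op: "open cut_plane"
    unfolding cut_plane_def
    by (auto intro!: open_Compl closed_Int closed_halfspace_Re_ge closed_Collect_eq continuous_intros)
  have "starlike cut_plane"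
    unfolding starlike_def
  proof (intro bexI ballI subsetI)
    show "(0::complex) \<in> cut_plane"
      by (simp add: cut_plane_def)
    fix x y :: complex
    assume x: "x \<in> cut_plane" and "y \<in> closed_segment 0 x"
    then obtain u where u: "0 \<le> u" "u \<le> 1" and y: "y = u *\<^sub>R x"
      by (auto simp: in_segment)
    show "y \<in> cut_plane"
    proof (rule ccontr)
      assume "y \<notin> cut_plane"
      then have "u * Im x = 0" and ge: "1 \<le> u * Re x"
        by (auto simp: cut_plane_def y)
      then have "Im x = 0" by auto
      with x have "Re x < 1"
        by (auto simp: cut_plane_def)
      moreover have "u * Re x \<le> max 0 (Re x)"
        using u by (cases "0 \<le> Re x") (auto simp: mult_left_le_one_le mult_nonneg_nonpos max_def)
      ultimately show False
        using ge by auto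
    qed
  qed
  then have conn: "connected cut_plane"
    by (rule starlike_imp_connected)
  have sub: "ball 0 1 \<subseteq> cut_plane"
  proof
    fix w :: complex
    assume "w \<in> ball 0 1"
    then have "Re w < 1"
      using complex_Re_le_cmod[of w] by simp
    then show "w \<in> cut_plane"
      by (simp add: cut_plane_def)
  qed
  have "?G z - F z = 0"
  proof (rule analytic_continuation[of "\<lambda>z. ?G z - F z" cut_plane "ball 0 1" 0])
    show "(\<lambda>z. ?G z - F z) holomorphic_on cut_plane"
      using F G by (auto intro: holomorphic_intros)
    show "(0::complex) islimpt ball 0 1"
      by (simp add: islimpt_ball)
    show "\<And>z. z \<in> ball 0 1 \<Longrightarrow> ?G z - F z = 0"
      using G F_series by auto
  qed (use op conn sub z in \<open>auto simp: cut_plane_def\<close>)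
  then show ?thesis by simp
qed


section \<open>Fractional Brownian motion\<close>

definition fbm_covariance :: "real \<Rightarrow> real \<Rightarrow> real \<Rightarrow> real" where
  "fbm_covariance H t \<tau> =
     (t powr (2 * H) + \<tau> powr (2 * H) - \<bar>t - \<tau>\<bar> powr (2 * H)) / 2"

text \<open>Constants count as (degenerate) Gaussian random variables.\<close>

definition gaussian_variable :: "'a measure \<Rightarrow> ('a \<Rightarrow> real) \<Rightarrow> bool" where
  "gaussian_variable M Y \<longleftrightarrow> Y \<in> borel_measurable M \<and>
     ((\<exists>\<mu> \<sigma>. 0 < \<sigma> \<and> distributed M lborel Y (normal_density \<mu> \<sigma>)) \<or>
      (\<exists>\<mu>. AE \<omega> in M. Y \<omega> = \<mu>))"

locale fractional_brownian_motion = prob_space M for M :: "'a measure" +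
  fixes H :: real and X :: "real \<Rightarrow> 'a \<Rightarrow> real"
  assumes hurst: "0 < H" "H < 1"
    and gaussian_process:
      "\<And>J c. finite J \<Longrightarrow> J \<subseteq> {0..} \<Longrightarrow> gaussian_variable M (\<lambda>\<omega>. \<Sum>t\<in>J. c t * X t \<omega>)"
    and centered: "\<And>t. 0 \<le> t \<Longrightarrow> expectation (X t) = 0"
    and starts_at_0: "AE \<omega> in M. X 0 \<omega> = 0"
    and covariance:
      "\<And>t \<tau>. 0 \<le> t \<Longrightarrow> 0 \<le> \<tau> \<Longrightarrow> expectation (\<lambda>\<omega>. X t \<omega> * X \<tau> \<omega>) = fbm_covariance H t \<tau>"

definition fbm_const :: "real \<Rightarrow> real" where
  "fbm_const H = sqrt (2 * H * Gamma (H + 1/2) * Gamma (3/2 - H) / Gamma (2 - 2 * H))"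

text \<open>
  The hypergeometric function is real at the points \<open>1 - t/\<tau> < 0\<close> where it is used, so that
  \<open>Re\<close> only changes the type. The value on the null set \<open>\<tau> \<le> 0 < t\<close> is irrelevant.
\<close>

definition fbm_kernel :: "real \<Rightarrow> real \<Rightarrow> real \<Rightarrow> real" where
  "fbm_kernel H t \<tau> =
     (if 0 < \<tau> \<and> \<tau> < t
      then fbm_const H / Gamma (H + 1/2) * (t - \<tau>) powr (H - 1/2) *
           Re (hypergeo_2F1 (of_real (1/2 - H)) (of_real (H - 1/2)) (of_real (H + 1/2))
                 (of_real (1 - t / \<tau>)))
      else 0)"

definition fbm_operator :: "real \<Rightarrow> (real \<Rightarrow> real) \<Rightarrow> real \<Rightarrow> real" where
  "fbm_operator H \<phi> t = (LINT \<tau>|lebesgue_on {0..t}. fbm_kernel H t \<tau> * \<phi> \<tau>)"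


section \<open>Spectral characteristics relative to a basis of \<open>L\<^sub>2([0,T])\<close>\<close>

definition spectral_char_process ::
  "real \<Rightarrow> (nat \<Rightarrow> real \<Rightarrow> real) \<Rightarrow> (real \<Rightarrow> 'a \<Rightarrow> real) \<Rightarrow> nat \<Rightarrow> 'a \<Rightarrow> real" where
  "spectral_char_process T q X i \<omega> = (LINT t|lebesgue_on {0..T}. q i t * X t \<omega>)"

definition spectral_char_kernel ::
  "real \<Rightarrow> (nat \<Rightarrow> real \<Rightarrow> real) \<Rightarrow> (real \<Rightarrow> real \<Rightarrow> real) \<Rightarrow> nat \<Rightarrow> nat \<Rightarrow> real" where
  "spectral_char_kernel T q k i j =
     (LINT t|lebesgue_on {0..T}. LINT \<tau>|lebesgue_on {0..T}. q i t * q j \<tau> * k t \<tau>)"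

definition spectral_char_operator ::
  "real \<Rightarrow> (nat \<Rightarrow> real \<Rightarrow> real) \<Rightarrow> ((real \<Rightarrow> real) \<Rightarrow> real \<Rightarrow> real) \<Rightarrow> nat \<Rightarrow> nat \<Rightarrow> real" where
  "spectral_char_operator T q A i j = (LINT t|lebesgue_on {0..T}. q i t * A (q j) t)"

lemma spectral_char_operator_eq_kernel:
  "spectral_char_operator T q (fbm_operator H) = spectral_char_kernel T q (fbm_kernel H)"
proof (intro ext)
  fix i j
  have "q i t * fbm_operator H (q j) t =
      (LINT \<tau>|lebesgue_on {0..T}. q i t * q j \<tau> * fbm_kernel H t \<tau>)" if t: "t \<in> {0..T}" for t
  proof -
    have "(LINT \<tau>|lebesgue_on {0..t}. fbm_kernel H t \<tau> * q j \<tau>) =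
        (LINT \<tau>|lebesgue_on {0..T}. fbm_kernel H t \<tau> * q j \<tau>)"
      using t
      by (subst (1 2) integral_restrict_space)
         (auto intro!: Bochner_Integration.integral_cong simp: indicator_def fbm_kernel_def)
    also have "q i t * \<dots> = (LINT \<tau>|lebesgue_on {0..T}. q i t * (fbm_kernel H t \<tau> * q j \<tau>))"
      by simp
    finally show ?thesis
      by (simp add: fbm_operator_def mult_ac)
  qed
  then show "spectral_char_operator T q (fbm_operator H) i j =
      spectral_char_kernel T q (fbm_kernel H) i j"
    unfolding spectral_char_operator_def spectral_char_kernel_def
    by (intro Bochner_Integration.integral_cong) auto
qed

end

theory Submission
  imports Defs
begin

text \<open>
  Put \<open>c\<^sub>j(t) = (q\<^sub>j, k\<^sub>H(t, \<cdot>))\<close> and \<open>D\<^sub>n(t) = B\<^sub>H(t) - \<Sum>j<n. c\<^sub>j(t) V\<^sub>j\<close>. By the Wiener isometry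
  \<open>V\<close> is orthonormal and \<open>c\<^sub>j(t) = E B\<^sub>H(t) V\<^sub>j\<close>, so that \<open>E D\<^sub>n(t)\<^sup>2\<close> is the squared remainder of the
  expansion of \<open>k\<^sub>H(t, \<cdot>)\<close> in the basis; it tends to \<open>0\<close> and is bounded by
  \<open>E B\<^sub>H(t)\<^sup>2 = t\<^sup>2\<^sup>H\<close>. Since \<open>\<integral> q\<^sub>i(t) D\<^sub>n(t) dt\<close> is the remainder of the series for the
  spectral characteristic of \<open>B\<^sub>H\<close>, the Cauchy-Schwarz inequality bounds its second moment by
  \<open>\<integral> E D\<^sub>n(t)\<^sup>2 dt\<close>, which vanishes in the limit by dominated convergence. Measurability of \<open>c\<^sub>j\<close>
  comes from \<open>c\<^sub>j(t) = E B\<^sub>H(t) V\<^sub>j\<close>, so no regularity of the kernel in \<open>t\<close> is needed.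
\<close>

section \<open>Square-integrable functions\<close>

lemma square_integrable_measurable [measurable_dest]:
  "square_integrable M f \<Longrightarrow> f \<in> borel_measurable M"
  by (simp add: square_integrable_def)

lemma square_integrable_integrable_mult:
  assumes "square_integrable M f" and "square_integrable M g"
  shows "integrable M (\<lambda>x. f x * g x)"
proof (rule Bochner_Integration.integrable_bound)
  show "integrable M (\<lambda>x. (f x)\<^sup>2 + (g x)\<^sup>2)"
    using assms by (simp add: square_integrable_def)
  show "(\<lambda>x. f x * g x) \<in> borel_measurable M"
    using assms by measurable
  have "\<bar>a * b\<bar> \<le> a\<^sup>2 + b\<^sup>2" for a b :: real
    using sum_squares_bound[of "\<bar>a\<bar>" "\<bar>b\<bar>"] zero_le_power2[of a] zero_le_power2[of b]
    unfolding abs_mult power2_abs by linarith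
  then show "AE x in M. norm (f x * g x) \<le> norm ((f x)\<^sup>2 + (g x)\<^sup>2)"
    by simp
qed

lemma square_integrable_cmult:
  assumes "square_integrable M f"
  shows "square_integrable M (\<lambda>x. c * f x)"
  using assms by (auto simp: square_integrable_def power_mult_distrib)

lemma square_integrable_add:
  assumes "square_integrable M f" and "square_integrable M g"
  shows "square_integrable M (\<lambda>x. f x + g x)"
  using assms square_integrable_integrable_mult[OF assms]
  by (auto simp: square_integrable_def power2_sum mult.assoc)

lemma square_integrable_diff:
  assumes "square_integrable M f" and "square_integrable M g"
  shows "square_integrable M (\<lambda>x. f x - g x)"
  using square_integrable_add[OF assms(1) square_integrable_cmult[OF assms(2), of "-1"]] by simp

lemma square_integrable_sum:
  "(\<And>i. i \<in> I \<Longrightarrow> square_integrable M (f i)) \<Longrightarrow> square_integrable M (\<lambda>x. \<Sum>i\<in>I. f i x)"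
  by (induction I rule: infinite_finite_induct)
     (simp_all add: square_integrable_add, simp_all add: square_integrable_def)

lemma square_integrable_cong_AE:
  assumes "square_integrable M f" and "g \<in> borel_measurable M" and "AE x in M. f x = g x"
  shows "square_integrable M g"
  using assms unfolding square_integrable_def
  by (auto intro: integrable_cong_AE_imp)

text \<open>Cauchy-Schwarz. With \<open>a\<close>, \<open>c\<close> the squared norms and
  \<open>b\<close> the inner product, the nonnegative integral of
  \<open>(a * g x - b * f x)\<^sup>2\<close> equals \<open>a * (a * c - b\<^sup>2)\<close>. Dividing
  by \<open>a\<close> finishes, except when \<open>a = 0\<close>, where \<open>f\<close> vanishes
  almost everywhere and so does \<open>b\<close>.\<close>

lemma integral_mult_square_le:
  assumes f: "square_integrable M f" and g: "square_integrable M g"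
  shows "(LINT x|M. f x * g x)\<^sup>2 \<le> (LINT x|M. (f x)\<^sup>2) * (LINT x|M. (g x)\<^sup>2)"
proof -
  define a b c where "a = (LINT x|M. (f x)\<^sup>2)" and "b = (LINT x|M. f x * g x)"
    and "c = (LINT x|M. (g x)\<^sup>2)"
  have [simp]: "integrable M (\<lambda>x. (f x)\<^sup>2)" "integrable M (\<lambda>x. (g x)\<^sup>2)"
    "integrable M (\<lambda>x. f x * g x)"
    using f g square_integrable_integrable_mult[OF f g] by (auto simp: square_integrable_def)
  have "0 \<le> (LINT x|M. (a * g x - b * f x)\<^sup>2)"
    by simp
  also have "\<dots> = (LINT x|M. a\<^sup>2 * (g x)\<^sup>2 - (2 * a * b) * (f x * g x) + b\<^sup>2 * (f x)\<^sup>2)"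
    by (simp add: power2_eq_square algebra_simps)
  also have "\<dots> = a\<^sup>2 * c - 2 * a * b * b + b\<^sup>2 * a"
    by (simp add: a_def b_def c_def)
  also have "\<dots> = a * (a * c - b\<^sup>2)"
    by (simp add: power2_eq_square algebra_simps)
  finally have ge: "0 \<le> a * (a * c - b\<^sup>2)" .
  have "0 \<le> a"
    by (simp add: a_def)
  show ?thesis
  proof (cases "a = 0")
    case True
    then have "AE x in M. (f x)\<^sup>2 = 0"
      by (simp add: a_def integral_nonneg_eq_0_iff_AE)
    then have "AE x in M. f x * g x = 0"
      by eventually_elim simp
    then have "b = 0"
      unfolding b_def by (rule integral_eq_zero_AE)
    then show ?thesis
      using \<open>a = 0\<close> by (simp add: a_def b_def)
  next
    case False
    with \<open>0 \<le> a\<close> have "0 < a"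
      by simp
    with ge have "0 \<le> a * c - b\<^sup>2"
      by (simp add: zero_le_mult_iff)
    then show ?thesis
      by (simp add: a_def b_def c_def)
  qed
qed

lemma abs_integral_mult_le:
  assumes "square_integrable M f" and "square_integrable M g"
  shows "\<bar>LINT x|M. f x * g x\<bar> \<le> sqrt (LINT x|M. (f x)\<^sup>2) * sqrt (LINT x|M. (g x)\<^sup>2)"
  using real_sqrt_le_mono[OF integral_mult_square_le[OF assms]]
  by (simp add: real_sqrt_mult)

text \<open>Joint continuity of the inner product. With errors \<open>u = f - fn\<close> and
  \<open>v = g - gn\<close> one has fn gn = f g - u g - f v + u v, and Cauchy-Schwarz sends the last
  three integrals to 0.\<close>

lemma tendsto_integral_mult:
  assumes f: "square_integrable M f" and g: "square_integrable M g"
    and fn: "\<And>n. square_integrable M (fn n)" and gn: "\<And>n. square_integrable M (gn n)"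
    and f_lim: "(\<lambda>n. LINT x|M. (f x - fn n x)\<^sup>2) \<longlonglongrightarrow> 0"
    and g_lim: "(\<lambda>n. LINT x|M. (g x - gn n x)\<^sup>2) \<longlonglongrightarrow> 0"
  shows "(\<lambda>n. LINT x|M. fn n x * gn n x) \<longlonglongrightarrow> (LINT x|M. f x * g x)"
proof -
  let ?u = "\<lambda>n x. f x - fn n x" and ?v = "\<lambda>n x. g x - gn n x"
  have u: "square_integrable M (?u n)" and v: "square_integrable M (?v n)" for n
    by (intro square_integrable_diff f g fn gn)+
  have sqrt_lim: "(\<lambda>n. sqrt (LINT x|M. (?u n x)\<^sup>2)) \<longlonglongrightarrow> 0"
      "(\<lambda>n. sqrt (LINT x|M. (?v n x)\<^sup>2)) \<longlonglongrightarrow> 0"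
    using tendsto_real_sqrt[OF f_lim] tendsto_real_sqrt[OF g_lim] by simp_all
  have uv: "(\<lambda>n. LINT x|M. ?u n x * ?v n x) \<longlonglongrightarrow> 0"
    by (rule Lim_null_comparison[OF _ tendsto_mult_zero[OF sqrt_lim]])
       (use abs_integral_mult_le[OF u v] in auto)
  have ug: "(\<lambda>n. LINT x|M. ?u n x * g x) \<longlonglongrightarrow> 0"
    by (rule Lim_null_comparison[OF _ tendsto_mult_left_zero[OF sqrt_lim(1), of "sqrt (LINT x|M. (g x)\<^sup>2)"]])
       (use abs_integral_mult_le[OF u g] in auto)
  have fv: "(\<lambda>n. LINT x|M. f x * ?v n x) \<longlonglongrightarrow> 0"
    by (rule Lim_null_comparison[OF _ tendsto_mult_right_zero[OF sqrt_lim(2), of "sqrt (LINT x|M. (f x)\<^sup>2)"]])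
       (use abs_integral_mult_le[OF f v] in auto)
  have "(LINT x|M. fn n x * gn n x) =
      (LINT x|M. f x * g x) - (LINT x|M. ?u n x * g x) - (LINT x|M. f x * ?v n x)
        + (LINT x|M. ?u n x * ?v n x)" for n
  proof -
    have "(LINT x|M. fn n x * gn n x) =
        (LINT x|M. f x * g x - ?u n x * g x - f x * ?v n x + ?u n x * ?v n x)"
      by (rule Bochner_Integration.integral_cong) (auto simp: algebra_simps)
    then show ?thesis
      by (simp only: Bochner_Integration.integral_add Bochner_Integration.integral_diff
          Bochner_Integration.integrable_add Bochner_Integration.integrable_diff
          square_integrable_integrable_mult f g u v)
  qed
  then show ?thesis
    using tendsto_add[OF tendsto_diff[OF tendsto_diff[OF tendsto_const ug] fv] uv]
    by simp
qed

text \<open>Pythagoras, one term at a time: \<open>e n\<close> is orthogonal to the terms already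
  subtracted, so its coefficient in the current remainder is still \<open>c n\<close>, and removing
  it lowers the squared norm by \<open>(c n)\<^sup>2\<close>. The lemma is applied twice, to the
  kernel with the basis \<open>q\<close> and to the process with the variables \<open>V\<close>;
  comparing the two results is the core of the argument.\<close>

lemma orthonormal_remainder:
  assumes f: "square_integrable M f" and e: "\<And>j. square_integrable M (e j)"
    and orth: "\<And>i j. (LINT x|M. e i x * e j x) = (if i = j then 1 else (0::real))"
    and c: "\<And>j. c j = (LINT x|M. e j x * f x)"
  shows "(LINT x|M. (f x - (\<Sum>j<n::nat. c j * e j x))\<^sup>2) = (LINT x|M. (f x)\<^sup>2) - (\<Sum>j<n. (c j)\<^sup>2)"
proof (induction n)
  case (Suc n)
  let ?g = "\<lambda>x. f x - (\<Sum>j<n. c j * e j x)"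
  have g: "square_integrable M ?g"
    by (intro square_integrable_diff f square_integrable_sum square_integrable_cmult e)
  have "(LINT x|M. e n x * ?g x) = (LINT x|M. e n x * f x - (\<Sum>j<n. c j * (e n x * e j x)))"
    by (simp add: algebra_simps sum_distrib_left)
  also have "\<dots> = c n - (\<Sum>j<n. c j * (LINT x|M. e n x * e j x))"
    by (simp add: c Bochner_Integration.integral_sum square_integrable_integrable_mult e f)
  also have "\<dots> = c n"
    by (simp add: orth)
  finally have inner: "(LINT x|M. e n x * ?g x) = c n" .
  have "(LINT x|M. (f x - (\<Sum>j<Suc n. c j * e j x))\<^sup>2) =
      (LINT x|M. (?g x)\<^sup>2 - 2 * c n * (e n x * ?g x) + (c n)\<^sup>2 * (e n x * e n x))"
    by (rule Bochner_Integration.integral_cong) (auto simp: power2_eq_square algebra_simps)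
  also have "\<dots> = (LINT x|M. (?g x)\<^sup>2) - 2 * c n * c n + (c n)\<^sup>2"
    using g square_integrable_integrable_mult[OF e g, of n]
      square_integrable_integrable_mult[OF e e, of n n]
    by (simp add: inner orth square_integrable_def)
  finally show ?case
    unfolding Suc.IH by (simp add: power2_eq_square)
qed simp


section \<open>The Wiener isometry\<close>

lemma step_function_Cons:
  "step_function ((c, u, v) # xs) x = c * indicator {u<..v} x + step_function xs x"
  by (simp add: step_function_def)

lemma step_integral_Cons:
  "step_integral B ((c, u, v) # xs) \<omega> = c * (B v \<omega> - B u \<omega>) + step_integral B xs \<omega>"
  by (simp add: step_integral_def)

lemma step_function_eq_0:
  "steps_within a b xs \<Longrightarrow> x \<notin> {a..b} \<Longrightarrow> step_function xs x = 0"
  by (induction xs) (auto simp: steps_within_def step_function_def indicator_def)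

lemma finite_measure_lebesgue_on_Icc: "finite_measure (lebesgue_on {a..b::real})"
  by (intro finite_measure_lebesgue_on) simp

lemma square_integrable_indicator_Ioc:
  fixes a b :: real
  shows "square_integrable (lebesgue_on {a..b}) (indicator {u<..v})"
proof -
  interpret finite_measure "lebesgue_on {a..b}"
    by (rule finite_measure_lebesgue_on_Icc)
  have [measurable]: "(indicator {u<..v} :: real \<Rightarrow> real) \<in> borel_measurable (lebesgue_on {a..b})"
    by (intro measurable_restrict_space1 borel_measurable_indicator) simp
  show ?thesis
    unfolding square_integrable_def
  proof
    show "integrable (lebesgue_on {a..b}) (\<lambda>x. (indicat_real {u<..v} x)\<^sup>2)"
      by (rule integrable_const_bound[where B=1]) (simp add: indicator_def, measurable)
  qed measurable
qed

lemma square_integrable_step_function: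
  "square_integrable (lebesgue_on {a..b}) (step_function xs)"
proof (induction xs)
  case (Cons x xs)
  obtain c u v where "x = (c, u, v)"
    by (cases x)
  then have "step_function (x # xs) = (\<lambda>y. c * indicator {u<..v} y + step_function xs y)"
    by (auto simp: step_function_def)
  then show ?case
    using square_integrable_add[OF square_integrable_cmult[OF square_integrable_indicator_Ioc] Cons.IH]
    by simp
qed (simp add: square_integrable_def step_function_def[abs_def])

text \<open>The length of the overlap is written through minima because the Brownian covariance is a
  minimum: expanding the covariance of two increments bilinearly gives the same four terms. The
  formula holds for any relative position of the two intervals, so overlapping steps can be treated
  without a common refinement.\<close>

lemma integral_indicator_Ioc_mult:
  fixes a b :: real
  assumes "a \<le> u" "u \<le> v" "v \<le> b" "a \<le> u'" "u' \<le> v'" "v' \<le> b"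
  shows "(LINT x|lebesgue_on {a..b}. indicator {u<..v} x * indicator {u'<..v'} x) =
    min v v' - min v u' - min u v' + min u u'"
proof -
  have "(LINT x|lebesgue_on {a..b}. indicator {u<..v} x * indicator {u'<..v'} x) =
      (LINT x|lebesgue. indicator {max u u'<..min v v'} x :: real)"
    using assms
    by (subst integral_restrict_space, simp, intro Bochner_Integration.integral_cong refl)
       (auto simp: indicator_def)
  also have "\<dots> = measure lebesgue {max u u'<..min v v'}"
    by simp
  also have "\<dots> = max 0 (min v v' - max u u')"
    by (cases "max u u' \<le> min v v'") (auto simp: max_def)
  also have "\<dots> = min v v' - min v u' - min u v' + min u u'"
    using assms by (auto simp: min_def max_def)
  finally show ?thesis .
qed

section \<open>Second moments of Brownian increments\<close>

context brownian_motion
begin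

lemma
  assumes "0 \<le> s" "s \<le> t"
  shows square_integrable_increment: "square_integrable M (\<lambda>\<omega>. B t \<omega> - B s \<omega>)"
    and expectation_increment: "expectation (\<lambda>\<omega>. B t \<omega> - B s \<omega>) = 0"
    and expectation_increment_square: "expectation (\<lambda>\<omega>. (B t \<omega> - B s \<omega>)\<^sup>2) = t - s"
proof -
  have [measurable]: "B t \<in> borel_measurable M" "B s \<in> borel_measurable M"
    using assms random_variable by auto
  have "square_integrable M (\<lambda>\<omega>. B t \<omega> - B s \<omega>) \<and> expectation (\<lambda>\<omega>. B t \<omega> - B s \<omega>) = 0 \<and>
      expectation (\<lambda>\<omega>. (B t \<omega> - B s \<omega>)\<^sup>2) = t - s"
  proof (cases "s = t")
    case True
    then show ?thesis
      by (simp add: square_integrable_def)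
  next
    case False
    with assms have "s < t"
      by simp
    note D = normal_increments[OF assms(1) this]
    have E: "expectation (\<lambda>\<omega>. B t \<omega> - B s \<omega>) = 0"
      by (rule normal_distributed_expectation[OF _ D]) (use \<open>s < t\<close> in simp)
    have "variance (\<lambda>\<omega>. B t \<omega> - B s \<omega>) = (sqrt (t - s))\<^sup>2"
      by (rule normal_distributed_variance[OF _ D]) (use \<open>s < t\<close> in simp)
    then have V: "expectation (\<lambda>\<omega>. (B t \<omega> - B s \<omega>)\<^sup>2) = t - s"
      using \<open>s < t\<close> by (simp only: E) simp
    \<comment> \<open>A non-integrable function has integral 0 by convention, whereas
      \<open>V\<close> gives the positive value \<open>t - s\<close>.\<close>
    have "integrable M (\<lambda>\<omega>. (B t \<omega> - B s \<omega>)\<^sup>2)"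
      using V \<open>s < t\<close> not_integrable_integral_eq by fastforce
    with E V show ?thesis
      by (simp add: square_integrable_def)
  qed
  then show "square_integrable M (\<lambda>\<omega>. B t \<omega> - B s \<omega>)"
    and "expectation (\<lambda>\<omega>. B t \<omega> - B s \<omega>) = 0"
    and "expectation (\<lambda>\<omega>. (B t \<omega> - B s \<omega>)\<^sup>2) = t - s"
    by auto
qed

text \<open>Split the longer increment at \<open>s\<close>: the cross term vanishes by independence
  and centering, and the square of the common part contributes \<open>s\<close>. Increments from
  time 0 stand in for \<open>B\<close> itself because the moments are known for increments.\<close>

lemma expectation_from_start_mult_le:
  assumes "0 \<le> s" "s \<le> t"
  shows "expectation (\<lambda>\<omega>. (B s \<omega> - B 0 \<omega>) * (B t \<omega> - B 0 \<omega>)) = s"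
proof -
  \<comment> \<open>The time sequence 0, s, t, t, ...: \<open>independent_increments\<close> asks
    for a monotone infinite sequence, of which only the first two increments are used below.\<close>
  define \<tau> where "\<tau> k = (if k = 0 then 0 else if k = Suc 0 then s else t)" for k :: nat
  have s: "square_integrable M (\<lambda>\<omega>. B s \<omega> - B 0 \<omega>)"
    and st: "square_integrable M (\<lambda>\<omega>. B t \<omega> - B s \<omega>)"
    using assms by (auto intro: square_integrable_increment)
  then have int: "integrable M (\<lambda>\<omega>. B s \<omega> - B 0 \<omega>)" "integrable M (\<lambda>\<omega>. B t \<omega> - B s \<omega>)"
    by (auto simp: square_integrable_def intro: square_integrable_imp_integrable)
  have "mono \<tau>"
    using assms by (auto simp: \<tau>_def mono_def)
  then have "indep_vars (\<lambda>_. borel) (\<lambda>k \<omega>. B (\<tau> (Suc k)) \<omega> - B (\<tau> k) \<omega>) {..<2}"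
    by (rule independent_increments) (simp add: \<tau>_def)
  then have "expectation (\<lambda>\<omega>. \<Prod>k<2. B (\<tau> (Suc k)) \<omega> - B (\<tau> k) \<omega>) =
      (\<Prod>k<2. expectation (\<lambda>\<omega>. B (\<tau> (Suc k)) \<omega> - B (\<tau> k) \<omega>))"
    by (rule indep_vars_lebesgue_integral[rotated])
       (use int in \<open>auto simp: \<tau>_def less_2_cases_iff\<close>)
  then have indep: "expectation (\<lambda>\<omega>. (B s \<omega> - B 0 \<omega>) * (B t \<omega> - B s \<omega>)) = 0"
    using assms by (simp add: \<tau>_def numeral_2_eq_2 expectation_increment)
  have "expectation (\<lambda>\<omega>. (B s \<omega> - B 0 \<omega>) * (B t \<omega> - B 0 \<omega>)) =
      expectation (\<lambda>\<omega>. (B s \<omega> - B 0 \<omega>)\<^sup>2 + (B s \<omega> - B 0 \<omega>) * (B t \<omega> - B s \<omega>))"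
    by (rule Bochner_Integration.integral_cong) (auto simp: power2_eq_square algebra_simps)
  also have "\<dots> = s"
    using s square_integrable_integrable_mult[OF s st] assms
    by (simp add: indep expectation_increment_square square_integrable_def)
  finally show ?thesis .
qed

lemma expectation_from_start_mult:
  assumes "0 \<le> s" "0 \<le> t"
  shows "expectation (\<lambda>\<omega>. (B s \<omega> - B 0 \<omega>) * (B t \<omega> - B 0 \<omega>)) = min s t"
  using expectation_from_start_mult_le[of s t] expectation_from_start_mult_le[of t s] assms
  by (cases "s \<le> t") (auto simp: mult.commute min_def)

lemma expectation_increment_mult:
  assumes "0 \<le> u" "u \<le> v" "0 \<le> u'" "u' \<le> v'"
  shows "expectation (\<lambda>\<omega>. (B v \<omega> - B u \<omega>) * (B v' \<omega> - B u' \<omega>)) =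
    min v v' - min v u' - min u v' + min u u'"
proof -
  let ?W = "\<lambda>t \<omega>. B t \<omega> - B 0 \<omega>"
  have W: "square_integrable M (?W t)" if "0 \<le> t" for t
    using that by (intro square_integrable_increment) auto
  have "expectation (\<lambda>\<omega>. (B v \<omega> - B u \<omega>) * (B v' \<omega> - B u' \<omega>)) =
      expectation (\<lambda>\<omega>. ?W v \<omega> * ?W v' \<omega> - ?W v \<omega> * ?W u' \<omega> - ?W u \<omega> * ?W v' \<omega> + ?W u \<omega> * ?W u' \<omega>)"
    by (rule Bochner_Integration.integral_cong) (auto simp: algebra_simps)
  also have "\<dots> = expectation (\<lambda>\<omega>. ?W v \<omega> * ?W v' \<omega>) - expectation (\<lambda>\<omega>. ?W v \<omega> * ?W u' \<omega>)
      - expectation (\<lambda>\<omega>. ?W u \<omega> * ?W v' \<omega>) + expectation (\<lambda>\<omega>. ?W u \<omega> * ?W u' \<omega>)"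
    using assms
    by (simp only: Bochner_Integration.integral_add Bochner_Integration.integral_diff
          Bochner_Integration.integrable_add Bochner_Integration.integrable_diff
          square_integrable_integrable_mult W order_trans)
  finally show ?thesis
    using assms by (simp add: expectation_from_start_mult)
qed

section \<open>The isometry for step functions and its passage to the limit\<close>

lemma square_integrable_step_integral:
  assumes "0 \<le> a" "steps_within a b xs"
  shows "square_integrable M (step_integral B xs)"
  using assms(2)
proof (induction xs)
  case (Cons x xs)
  obtain c u v where x: "x = (c, u, v)"
    by (cases x)
  then have "step_integral B (x # xs) = (\<lambda>\<omega>. c * (B v \<omega> - B u \<omega>) + step_integral B xs \<omega>)"
    by (auto simp: step_integral_Cons)
  moreover have "square_integrable M (\<lambda>\<omega>. B v \<omega> - B u \<omega>)"
    using Cons.prems assms(1) by (intro square_integrable_increment) (auto simp: x steps_within_def)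
  moreover have "square_integrable M (step_integral B xs)"
    using Cons by (simp add: steps_within_def)
  ultimately show ?case
    by (auto intro: square_integrable_add square_integrable_cmult)
qed (simp add: square_integrable_def step_integral_def[abs_def])

text \<open>Both sides are bilinear, so the isometry is built by induction on one list at a time.
  Here the first factor is a single step; the base comparison is the agreement of
  \<open>expectation_increment_mult\<close> with \<open>integral_indicator_Ioc_mult\<close>.\<close>

lemma step_isometry_increment:
  assumes "0 \<le> a" "a \<le> u" "u \<le> v" "v \<le> b" "steps_within a b ys"
  shows "expectation (\<lambda>\<omega>. (B v \<omega> - B u \<omega>) * step_integral B ys \<omega>) =
    (LINT x|lebesgue_on {a..b}. indicator {u<..v} x * step_function ys x)"
  using assms(5)
proof (induction ys)
  case (Cons y ys)
  obtain c u' v' where y: "y = (c, u', v')"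
    by (cases y)
  have ys: "steps_within a b ys" and bounds: "a \<le> u'" "u' \<le> v'" "v' \<le> b"
    using Cons.prems by (auto simp: y steps_within_def)
  have "expectation (\<lambda>\<omega>. (B v \<omega> - B u \<omega>) * step_integral B (y # ys) \<omega>) =
      expectation (\<lambda>\<omega>. c * ((B v \<omega> - B u \<omega>) * (B v' \<omega> - B u' \<omega>))
        + (B v \<omega> - B u \<omega>) * step_integral B ys \<omega>)"
    by (simp add: y step_integral_Cons algebra_simps)
  also have "\<dots> = c * expectation (\<lambda>\<omega>. (B v \<omega> - B u \<omega>) * (B v' \<omega> - B u' \<omega>))
      + expectation (\<lambda>\<omega>. (B v \<omega> - B u \<omega>) * step_integral B ys \<omega>)"
    using assms bounds square_integrable_step_integral[OF assms(1) ys]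
    by (subst Bochner_Integration.integral_add)
       (auto intro!: square_integrable_integrable_mult square_integrable_increment integrable_mult_right)
  also have "\<dots> = c * (LINT x|lebesgue_on {a..b}. indicator {u<..v} x * indicator {u'<..v'} x)
      + (LINT x|lebesgue_on {a..b}. indicator {u<..v} x * step_function ys x)"
    using assms bounds
    by (simp only: Cons.IH[OF ys] integral_indicator_Ioc_mult) (simp add: expectation_increment_mult)
  also have "\<dots> = (LINT x|lebesgue_on {a..b}. c * (indicator {u<..v} x * indicator {u'<..v'} x)
      + indicator {u<..v} x * step_function ys x)"
    by (subst Bochner_Integration.integral_add)
       (auto intro!: square_integrable_integrable_mult square_integrable_indicator_Ioc
          square_integrable_step_function integrable_mult_right)
  finally show ?case
    by (simp add: y step_function_Cons algebra_simps)
qed (simp add: step_integral_def step_function_def)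

lemma step_isometry:
  assumes "0 \<le> a" "steps_within a b xs" "steps_within a b ys"
  shows "expectation (\<lambda>\<omega>. step_integral B xs \<omega> * step_integral B ys \<omega>) =
    (LINT x|lebesgue_on {a..b}. step_function xs x * step_function ys x)"
  using assms(2)
proof (induction xs)
  case (Cons y xs)
  obtain c u v where y: "y = (c, u, v)"
    by (cases y)
  have xs: "steps_within a b xs" and bounds: "a \<le> u" "u \<le> v" "v \<le> b"
    using Cons.prems by (auto simp: y steps_within_def)
  have "expectation (\<lambda>\<omega>. step_integral B (y # xs) \<omega> * step_integral B ys \<omega>) =
      expectation (\<lambda>\<omega>. c * ((B v \<omega> - B u \<omega>) * step_integral B ys \<omega>)
        + step_integral B xs \<omega> * step_integral B ys \<omega>)"
    by (simp add: y step_integral_Cons algebra_simps)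
  also have "\<dots> = c * expectation (\<lambda>\<omega>. (B v \<omega> - B u \<omega>) * step_integral B ys \<omega>)
      + expectation (\<lambda>\<omega>. step_integral B xs \<omega> * step_integral B ys \<omega>)"
    using assms bounds square_integrable_step_integral[OF assms(1) xs]
      square_integrable_step_integral[OF assms(1,3)]
    by (subst Bochner_Integration.integral_add)
       (auto intro!: square_integrable_integrable_mult square_integrable_increment integrable_mult_right)
  also have "\<dots> = c * (LINT x|lebesgue_on {a..b}. indicator {u<..v} x * step_function ys x)
      + (LINT x|lebesgue_on {a..b}. step_function xs x * step_function ys x)"
    using assms bounds by (simp only: Cons.IH[OF xs] step_isometry_increment)
  also have "\<dots> = (LINT x|lebesgue_on {a..b}. c * (indicator {u<..v} x * step_function ys x)
      + step_function xs x * step_function ys x)"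
    by (subst Bochner_Integration.integral_add)
       (auto intro!: square_integrable_integrable_mult square_integrable_indicator_Ioc
          square_integrable_step_function integrable_mult_right)
  finally show ?case
    by (simp add: y step_function_Cons algebra_simps)
qed (simp add: step_integral_def step_function_def)

text \<open>The two approximating sequences may be unrelated. Pairing their n-th members,
  \<open>step_isometry\<close> equates the two sequences of inner products, and continuity of the
  inner product identifies their limits.\<close>

lemma wiener_isometry:
  assumes "0 \<le> a" and Y: "has_wiener_integral M B a b f Y" and Z: "has_wiener_integral M B a b g Z"
  shows "expectation (\<lambda>\<omega>. Y \<omega> * Z \<omega>) = (LINT x|lebesgue_on {a..b}. f x * g x)"
proof -
  obtain s where s: "\<And>n. steps_within a b (s n)"
    "(\<lambda>n. LINT x|lebesgue_on {a..b}. (f x - step_function (s n) x)\<^sup>2) \<longlonglongrightarrow> 0"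
    "(\<lambda>n. LINT \<omega>|M. (Y \<omega> - step_integral B (s n) \<omega>)\<^sup>2) \<longlonglongrightarrow> 0"
    using Y by (auto simp: has_wiener_integral_def)
  obtain r where r: "\<And>n. steps_within a b (r n)"
    "(\<lambda>n. LINT x|lebesgue_on {a..b}. (g x - step_function (r n) x)\<^sup>2) \<longlonglongrightarrow> 0"
    "(\<lambda>n. LINT \<omega>|M. (Z \<omega> - step_integral B (r n) \<omega>)\<^sup>2) \<longlonglongrightarrow> 0"
    using Z by (auto simp: has_wiener_integral_def)
  have "(\<lambda>n. expectation (\<lambda>\<omega>. step_integral B (s n) \<omega> * step_integral B (r n) \<omega>))
      \<longlonglongrightarrow> expectation (\<lambda>\<omega>. Y \<omega> * Z \<omega>)"
    using Y Z s r \<open>0 \<le> a\<close>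
    by (intro tendsto_integral_mult)
       (auto simp: has_wiener_integral_def intro: square_integrable_step_integral)
  moreover have "(\<lambda>n. LINT x|lebesgue_on {a..b}. step_function (s n) x * step_function (r n) x)
      \<longlonglongrightarrow> (LINT x|lebesgue_on {a..b}. f x * g x)"
    using Y Z s r
    by (intro tendsto_integral_mult)
       (auto simp: has_wiener_integral_def square_integrable_step_function)
  ultimately show ?thesis
    by (simp add: step_isometry[OF \<open>0 \<le> a\<close> s(1) r(1)] LIMSEQ_unique)
qed

end

text \<open>The variable \<open>BH t\<close> is an integral over \<open>[0,t]\<close> and each
  \<open>V j\<close> one over \<open>[0,T]\<close>, while the isometry asks for a common interval.
  Since \<open>f\<close> and all approximating step functions vanish outside \<open>{a..t}\<close>,
  enlarging the interval leaves every integral in the definition unchanged, and the same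
  approximating sequence serves.\<close>

lemma has_wiener_integral_extend:
  assumes Y: "has_wiener_integral M B a t f Y" and "t \<le> b"
    and f: "\<And>x. x \<notin> {a..t} \<Longrightarrow> f x = 0"
  shows "has_wiener_integral M B a b f Y"
proof -
  have eq: "(LINT x|lebesgue_on {a..t}. h x) = (LINT x|lebesgue_on {a..b}. h x)"
    and eq': "integrable (lebesgue_on {a..t}) h \<longleftrightarrow> integrable (lebesgue_on {a..b}) h"
    and eq'': "h \<in> borel_measurable (lebesgue_on {a..t}) \<longleftrightarrow> h \<in> borel_measurable (lebesgue_on {a..b})"
    if h: "\<And>x. x \<notin> {a..t} \<Longrightarrow> h x = 0" for h :: "real \<Rightarrow> real"
  proof -
    have "(\<lambda>x. indicator {a..t} x *\<^sub>R h x) = (\<lambda>x. indicator {a..b} x *\<^sub>R h x)"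
      using h \<open>t \<le> b\<close> by (fastforce simp: indicator_def)
    then show "(LINT x|lebesgue_on {a..t}. h x) = (LINT x|lebesgue_on {a..b}. h x)"
      and "integrable (lebesgue_on {a..t}) h \<longleftrightarrow> integrable (lebesgue_on {a..b}) h"
      and "h \<in> borel_measurable (lebesgue_on {a..t}) \<longleftrightarrow> h \<in> borel_measurable (lebesgue_on {a..b})"
      by (simp_all add: integral_restrict_space integrable_restrict_space
          borel_measurable_restrict_space_iff)
  qed
  obtain s where s: "\<And>n. steps_within a t (s n)"
    "(\<lambda>n. LINT x|lebesgue_on {a..t}. (f x - step_function (s n) x)\<^sup>2) \<longlonglongrightarrow> 0"
    "(\<lambda>n. LINT \<omega>|M. (Y \<omega> - step_integral B (s n) \<omega>)\<^sup>2) \<longlonglongrightarrow> 0"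
    using Y by (auto simp: has_wiener_integral_def)
  have "square_integrable (lebesgue_on {a..b}) f"
    using Y f eq'[of "\<lambda>x. (f x)\<^sup>2"] eq''[of f]
    by (auto simp: has_wiener_integral_def square_integrable_def)
  moreover have "steps_within a b (s n)" for n
    using s(1)[of n] \<open>t \<le> b\<close> by (fastforce simp: steps_within_def)
  moreover have "(LINT x|lebesgue_on {a..t}. (f x - step_function (s n) x)\<^sup>2) =
      (LINT x|lebesgue_on {a..b}. (f x - step_function (s n) x)\<^sup>2)" for n
    by (rule eq) (simp add: f step_function_eq_0[OF s(1)])
  ultimately show ?thesis
    using Y s unfolding has_wiener_integral_def by auto
qed


section \<open>Integrating a square-integrable random function\<close>

text \<open>Fubini makes \<open>D\<close> square integrable on the product, hence along almost every
  path. Cauchy-Schwarz on each such path bounds the squared integral by the norm of \<open>h\<close>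
  times that of the path; integrating this over \<open>M2\<close> and exchanging the integrals gives
  the final estimate.\<close>

lemma (in pair_sigma_finite) integral_random_function:
  assumes D [measurable]: "case_prod D \<in> borel_measurable (M1 \<Otimes>\<^sub>M M2)"
    and sq: "AE t in M1. square_integrable M2 (D t)"
    and int: "integrable M1 (\<lambda>t. LINT \<omega>|M2. (D t \<omega>)\<^sup>2)"
    and h: "square_integrable M1 h"
  shows AE_square_integrable_path: "AE \<omega> in M2. square_integrable M1 (\<lambda>t. D t \<omega>)"
    and square_integrable_integral_path: "square_integrable M2 (\<lambda>\<omega>. LINT t|M1. h t * D t \<omega>)"
    and integral_square_integral_path_le:
      "(LINT \<omega>|M2. (LINT t|M1. h t * D t \<omega>)\<^sup>2) \<le>
        (LINT t|M1. (h t)\<^sup>2) * (LINT t|M1. LINT \<omega>|M2. (D t \<omega>)\<^sup>2)"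
proof -
  have [measurable]: "h \<in> borel_measurable M1"
    using h by measurable
  have D2: "integrable (M1 \<Otimes>\<^sub>M M2) (\<lambda>(t, \<omega>). (D t \<omega>)\<^sup>2)"
    by (rule Fubini_integrable) (use sq int in \<open>auto simp: square_integrable_def\<close>)
  have "AE \<omega> in M2. \<omega> \<in> space M2"
    by simp
  with AE_integrable_snd[OF D2]
  show path: "AE \<omega> in M2. square_integrable M1 (\<lambda>t. D t \<omega>)"
    by eventually_elim (simp add: square_integrable_def)
  let ?C = "LINT t|M1. (h t)\<^sup>2"
  let ?X = "\<lambda>\<omega>. LINT t|M1. h t * D t \<omega>"
  have le: "AE \<omega> in M2. (?X \<omega>)\<^sup>2 \<le> ?C * (LINT t|M1. (D t \<omega>)\<^sup>2)"
    using path by eventually_elim (rule integral_mult_square_le[OF h])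
  have X [measurable]: "?X \<in> borel_measurable M2"
    by measurable
  have bound: "integrable M2 (\<lambda>\<omega>. ?C * (LINT t|M1. (D t \<omega>)\<^sup>2))"
    using integrable_snd[OF D2] by simp
  have X2: "integrable M2 (\<lambda>\<omega>. (?X \<omega>)\<^sup>2)"
    by (rule Bochner_Integration.integrable_bound[OF bound]) (use le in auto)
  with X show "square_integrable M2 ?X"
    by (simp add: square_integrable_def)
  have "(LINT \<omega>|M2. (?X \<omega>)\<^sup>2) \<le> (LINT \<omega>|M2. ?C * (LINT t|M1. (D t \<omega>)\<^sup>2))"
    by (rule integral_mono_AE[OF X2 bound le])
  also have "\<dots> = ?C * (LINT t|M1. LINT \<omega>|M2. (D t \<omega>)\<^sup>2)"
    using integral_fst[OF D2] integral_snd[OF D2] by simp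
  finally show "(LINT \<omega>|M2. (?X \<omega>)\<^sup>2) \<le> ?C * (LINT t|M1. LINT \<omega>|M2. (D t \<omega>)\<^sup>2)" .
qed

text \<open>Lebesgue measure is complete, so changing a function on a null set preserves
  measurability. Extension by 0 outside \<open>S\<close> moves the question to the whole
  line.\<close>

lemma borel_measurable_lebesgue_on_AE:
  fixes f g :: "real \<Rightarrow> real"
  assumes f: "f \<in> borel_measurable (lebesgue_on S)" and S: "S \<in> sets lebesgue"
    and ae: "AE x in lebesgue_on S. f x = g x"
  shows "g \<in> borel_measurable (lebesgue_on S)"
proof -
  have "AE x in lebesgue. x \<in> S \<longrightarrow> f x = g x"
    using ae S by (simp add: AE_restrict_space_iff)
  then have "AE x in lebesgue. (if x \<in> S then f x else 0) = (if x \<in> S then g x else 0)"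
    by eventually_elim simp
  moreover have "(\<lambda>x. if x \<in> S then f x else 0) \<in> borel_measurable lebesgue"
    using f S by (simp add: borel_measurable_if)
  ultimately have "(\<lambda>x. if x \<in> S then g x else 0) \<in> borel_measurable lebesgue"
    by (rule borel_measurable_AE[rotated])
  then show ?thesis
    using S by (simp add: borel_measurable_if)
qed

section \<open>The series for the spectral characteristic of fractional Brownian motion\<close>

lemma spectral_char_operator_fbm_eq:
  "spectral_char_operator T q (fbm_operator H) i j =
    (LINT t|lebesgue_on {0..T}. q i t * (LINT \<tau>|lebesgue_on {0..T}. q j \<tau> * fbm_kernel H t \<tau>))"
  by (simp add: spectral_char_operator_eq_kernel spectral_char_kernel_def mult.assoc)

theorem theorem1:
  fixes M :: "'a measure" and B BH :: "real \<Rightarrow> 'a \<Rightarrow> real" and T H :: real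
    and q :: "nat \<Rightarrow> real \<Rightarrow> real" and V :: "nat \<Rightarrow> 'a \<Rightarrow> real"
  assumes "complete_measure M"
    and "0 < T" and "0 < H" and "H < 1"
    and "brownian_motion M B"
    and "fractional_brownian_motion M H BH"
    and BH_measurable:
      "case_prod BH \<in> borel_measurable (completion (lebesgue_on {0..T} \<Otimes>\<^sub>M M))"
    and BH_representation:
      "\<And>t. 0 \<le> t \<Longrightarrow> has_wiener_integral M B 0 t (fbm_kernel H t) (BH t)"
    and "orthonormal_basis_L2 (lebesgue_on {0..T}) q"
    and V: "\<And>j. has_wiener_integral M B 0 T (q j) (V j)"
  shows "\<forall>i. \<exists>S. sums_in_mean_square M
                  (\<lambda>j \<omega>. spectral_char_operator T q (fbm_operator H) i j * V j \<omega>) S \<and>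
              (AE \<omega> in M. spectral_char_process T q BH i \<omega> = S \<omega>)"
proof
  fix i
  let ?L = "lebesgue_on {0..T}" and ?k = "fbm_kernel H"
  interpret brownian_motion M B by fact
  interpret X: fractional_brownian_motion M H BH by fact
  interpret L: finite_measure ?L by (rule finite_measure_lebesgue_on_Icc)
  interpret pair_sigma_finite ?L M ..
  interpret Q: pair_sigma_finite M ?L ..
  have q: "square_integrable ?L (q j)"
    and q_orth: "(LINT t|?L. q j t * q l t) = (if j = l then 1 else 0)"
    and q_complete: "square_integrable ?L f \<Longrightarrow>
        (\<lambda>n. LINT x|?L. (f x - (\<Sum>j<n. (LINT y|?L. q j y * f y) * q j x))\<^sup>2) \<longlonglongrightarrow> 0"
    for j l f
    using \<open>orthonormal_basis_L2 ?L q\<close> by (simp_all add: orthonormal_basis_L2_def)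
  have sq_V: "square_integrable M (V j)" for j
    using V by (simp add: has_wiener_integral_def)
  have V_orth: "expectation (\<lambda>\<omega>. V j \<omega> * V l \<omega>) = (if j = l then 1 else 0)" for j l
    using wiener_isometry[OF order_refl V V] by (simp add: q_orth)
  have [measurable]: "q j \<in> borel_measurable ?L" "V j \<in> borel_measurable M" for j
    using q sq_V by measurable
  have BH: "has_wiener_integral M B 0 T (?k t) (BH t)" if "t \<in> {0..T}" for t
    using that
    by (intro has_wiener_integral_extend[OF BH_representation]) (auto simp: fbm_kernel_def)

  \<comment> \<open>\<open>BH\<close> is jointly measurable only for the completed product, whereas
    the Fubini arguments work on the product sigma-algebra itself. The process is therefore replaced
    by a version \<open>G\<close> that differs from it on a null set of the product.\<close>
  obtain G' where G' [measurable]: "G' \<in> borel_measurable (?L \<Otimes>\<^sub>M M)"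
    and G'_eq: "AE p in ?L \<Otimes>\<^sub>M M. case_prod BH p = G' p"
    using completion_ex_borel_measurable_real[OF BH_measurable] by blast
  define G where "G t \<omega> = G' (t, \<omega>)" for t \<omega>
  have G [measurable]: "case_prod G \<in> borel_measurable (?L \<Otimes>\<^sub>M M)"
    by (simp add: G_def split_beta')
  have G_eq: "AE t in ?L. AE \<omega> in M. BH t \<omega> = G t \<omega>"
    using AE_pair[OF G'_eq] by (simp add: G_def)
  \<comment> \<open>Swapping the coordinates yields the null-set statement in the other order:
    almost every path of \<open>BH\<close> agrees with that of \<open>G\<close> at almost every
    time. This is what later transfers the result back to \<open>BH\<close>.\<close>
  have "AE p in M \<Otimes>\<^sub>M ?L. case_prod BH (case p of (\<omega>, t) \<Rightarrow> (t, \<omega>)) = G' (case p of (\<omega>, t) \<Rightarrow> (t, \<omega>))"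
    by (rule AE_distrD[OF measurable_pair_swap']) (subst distr_pair_swap[symmetric], rule G'_eq)
  then have G_eq': "AE \<omega> in M. AE t in ?L. BH t \<omega> = G t \<omega>"
    using Q.AE_pair by (force simp: G_def)

  \<comment> \<open>As an expectation, \<open>c j\<close> is measurable in \<open>t\<close> by
    construction; that it is the j-th coefficient of the kernel is shown for almost every
    \<open>t\<close> in \<open>good\<close>.\<close>
  define c where "c j t = expectation (\<lambda>\<omega>. V j \<omega> * G t \<omega>)" for j t
  have [measurable]: "c j \<in> borel_measurable ?L" for j
    unfolding c_def[abs_def] by measurable
  define D where "D n t \<omega> = G t \<omega> - (\<Sum>j<n. c j t * V j \<omega>)" for n t \<omega>
  have D [measurable]: "case_prod (D n) \<in> borel_measurable (?L \<Otimes>\<^sub>M M)" for n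
    unfolding D_def[abs_def] by measurable

  \<comment> \<open>The only exceptional times are those where \<open>G t\<close> fails to be a
    version of \<open>BH t\<close>, so all the claims, for all indices at once, share one null
    set.\<close>
  have good: "AE t in ?L. square_integrable M (G t) \<and>
      (\<forall>j. c j t = (LINT \<tau>|?L. q j \<tau> * ?k t \<tau>)) \<and>
      (\<forall>n. square_integrable M (D n t)) \<and>
      (\<forall>n. expectation (\<lambda>\<omega>. (D n t \<omega>)\<^sup>2) \<le> T powr (2 * H)) \<and>
      (\<forall>j. (c j t)\<^sup>2 \<le> T powr (2 * H)) \<and>
      (\<lambda>n. expectation (\<lambda>\<omega>. (D n t \<omega>)\<^sup>2)) \<longlonglongrightarrow> 0"
    using AE_space G_eq
  proof eventually_elim
    case (elim t)
    note eq = elim(2)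
    have t: "t \<in> {0..T}"
      using elim(1) by simp
    have k: "square_integrable ?L (?k t)" and sq_BH: "square_integrable M (BH t)"
      using BH[OF t] by (simp_all add: has_wiener_integral_def)
    have [measurable]: "G t \<in> borel_measurable M" "BH t \<in> borel_measurable M"
      using G elim(1) sq_BH by (auto simp: G_def[abs_def] square_integrable_def)
    have sq_G: "square_integrable M (G t)"
      by (rule square_integrable_cong_AE[OF sq_BH _ eq]) measurable
    have sq_D: "square_integrable M (D n t)" for n
      unfolding D_def[abs_def]
      by (intro square_integrable_diff sq_G square_integrable_sum square_integrable_cmult sq_V)
    have "c j t = expectation (\<lambda>\<omega>. V j \<omega> * BH t \<omega>)" for j
      unfolding c_def by (rule integral_cong_AE) (use eq in auto)
    then have c: "c j t = (LINT \<tau>|?L. q j \<tau> * ?k t \<tau>)" for j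
      using wiener_isometry[OF order_refl V BH[OF t]] by simp
    have "expectation (\<lambda>\<omega>. (G t \<omega>)\<^sup>2) = expectation (\<lambda>\<omega>. BH t \<omega> * BH t \<omega>)"
      by (rule integral_cong_AE) (use eq in \<open>auto simp: power2_eq_square\<close>)
    \<comment> \<open>The second moment is needed in two forms: the covariance gives an explicit
      value to bound by a constant, and the isometry gives the norm of the kernel.\<close>
    then have norm_G: "expectation (\<lambda>\<omega>. (G t \<omega>)\<^sup>2) = t powr (2 * H)"
        "expectation (\<lambda>\<omega>. (G t \<omega>)\<^sup>2) = (LINT \<tau>|?L. (?k t \<tau>)\<^sup>2)"
      using X.covariance[of t t] t wiener_isometry[OF order_refl BH[OF t] BH[OF t]]
      by (simp_all add: fbm_covariance_def power2_eq_square)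
    have t_le: "t powr (2 * H) \<le> T powr (2 * H)"
      using t \<open>0 < H\<close> by (intro powr_mono2) auto
    have norm_D: "expectation (\<lambda>\<omega>. (D n t \<omega>)\<^sup>2) =
        expectation (\<lambda>\<omega>. (G t \<omega>)\<^sup>2) - (\<Sum>j<n. (c j t)\<^sup>2)" for n
      unfolding D_def by (rule orthonormal_remainder[OF sq_G sq_V V_orth]) (simp add: c_def)
    have le: "expectation (\<lambda>\<omega>. (D n t \<omega>)\<^sup>2) \<le> T powr (2 * H)" for n
      using t_le sum_nonneg[of "{..<n}" "\<lambda>j. (c j t)\<^sup>2"] by (simp add: norm_D norm_G(1))
    have c_le: "(c j t)\<^sup>2 \<le> T powr (2 * H)" for j
    proof -
      have "(c j t)\<^sup>2 \<le> expectation (\<lambda>\<omega>. (V j \<omega>)\<^sup>2) * expectation (\<lambda>\<omega>. (G t \<omega>)\<^sup>2)"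
        unfolding c_def by (rule integral_mult_square_le[OF sq_V sq_G])
      also have "\<dots> = t powr (2 * H)"
        unfolding norm_G(1) using V_orth[of j j] by (simp add: power2_eq_square)
      finally show ?thesis
        using t_le by simp
    qed
    \<comment> \<open>Both remainders are the same squared norm minus the same sum of squared
      coefficients, so the completeness of \<open>q\<close> carries over to the expansion of
      \<open>G t\<close> in the variables \<open>V j\<close>.\<close>
    have "(LINT x|?L. (?k t x - (\<Sum>j<n. c j t * q j x))\<^sup>2) = expectation (\<lambda>\<omega>. (D n t \<omega>)\<^sup>2)" for n
      unfolding norm_D norm_G(2) by (rule orthonormal_remainder[OF k q q_orth c])
    then have "(\<lambda>n. expectation (\<lambda>\<omega>. (D n t \<omega>)\<^sup>2)) \<longlonglongrightarrow> 0"
      using q_complete[OF k] by (simp add: c)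
    then show ?case
      using sq_G c sq_D le c_le by blast
  qed
  have sq_D: "AE t in ?L. square_integrable M (D n t)" for n
    using good by eventually_elim blast
  have D_le: "AE t in ?L. norm (expectation (\<lambda>\<omega>. (D n t \<omega>)\<^sup>2)) \<le> T powr (2 * H)" for n
    using good by eventually_elim simp
  have meas_D2 [measurable]: "(\<lambda>t. expectation (\<lambda>\<omega>. (D n t \<omega>)\<^sup>2)) \<in> borel_measurable ?L" for n
    by measurable
  have int_D: "integrable ?L (\<lambda>t. expectation (\<lambda>\<omega>. (D n t \<omega>)\<^sup>2))" for n
    by (rule L.integrable_const_bound[OF D_le]) measurable
  have lim_D: "(\<lambda>n. LINT t|?L. expectation (\<lambda>\<omega>. (D n t \<omega>)\<^sup>2)) \<longlonglongrightarrow> 0"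
  proof -
    have "(\<lambda>n. LINT t|?L. expectation (\<lambda>\<omega>. (D n t \<omega>)\<^sup>2)) \<longlonglongrightarrow> (LINT t|?L. 0)"
    proof (rule integral_dominated_convergence[where w="\<lambda>_. T powr (2 * H)"])
      show "AE t in ?L. (\<lambda>n. expectation (\<lambda>\<omega>. (D n t \<omega>)\<^sup>2)) \<longlonglongrightarrow> 0"
        using good by eventually_elim blast
    qed (use D_le in auto)
    then show ?thesis
      by simp
  qed

  define S where "S \<omega> = (LINT t|?L. q i t * G t \<omega>)" for \<omega>
  define K where "K j = spectral_char_operator T q (fbm_operator H) i j" for j
  have sq_c: "square_integrable ?L (c j)" for j
    unfolding square_integrable_def
  proof
    have "AE t in ?L. (c j t)\<^sup>2 \<le> T powr (2 * H)"
      using good by eventually_elim blast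
    then have "AE t in ?L. norm ((c j t)\<^sup>2) \<le> T powr (2 * H)"
      by simp
    then show "integrable ?L (\<lambda>t. (c j t)\<^sup>2)"
      by (rule L.integrable_const_bound) measurable
  qed measurable
  have K: "K j = (LINT t|?L. q i t * c j t)" for j
  proof -
    have ae: "AE t in ?L. c j t = (LINT \<tau>|?L. q j \<tau> * ?k t \<tau>)"
      using good by eventually_elim blast
    \<comment> \<open>Measurability of the kernel coefficient in \<open>t\<close> is inherited from
      \<open>c j\<close>, with which it agrees almost everywhere.\<close>
    have [measurable]: "(\<lambda>t. LINT \<tau>|?L. q j \<tau> * ?k t \<tau>) \<in> borel_measurable ?L"
      by (rule borel_measurable_lebesgue_on_AE[OF _ _ ae]) auto
    show ?thesis
      unfolding K_def spectral_char_operator_fbm_eq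
      by (rule integral_cong_AE) (use ae in auto)
  qed
  have X_eq: "AE \<omega> in M. (LINT t|?L. q i t * D n t \<omega>) = S \<omega> - (\<Sum>j<n. K j * V j \<omega>)" for n
    \<comment> \<open>For \<open>n = 0\<close> the sum is empty and \<open>D 0\<close> is
      \<open>G\<close>, so this instance gives square-integrable paths of \<open>G\<close>, which
      justifies splitting the integral.\<close>
    using AE_square_integrable_path[OF D[of 0] sq_D int_D q]
  proof eventually_elim
    case (elim \<omega>)
    then have G: "square_integrable ?L (\<lambda>t. G t \<omega>)"
      by (simp add: D_def)
    have "(LINT t|?L. q i t * D n t \<omega>) =
        (LINT t|?L. q i t * G t \<omega> - (\<Sum>j<n. V j \<omega> * (q i t * c j t)))"
      by (simp add: D_def right_diff_distrib sum_distrib_left mult_ac)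
    also have "\<dots> = S \<omega> - (\<Sum>j<n. V j \<omega> * K j)"
      using square_integrable_integrable_mult[OF q[of i] G]
        square_integrable_integrable_mult[OF q[of i] sq_c]
      by (simp add: S_def K Bochner_Integration.integral_sum)
    finally show ?case
      by (simp add: mult.commute)
  qed
  have sq_S: "square_integrable M S"
    using square_integrable_integral_path[OF D[of 0] sq_D int_D q[of i]]
    by (simp add: D_def S_def[abs_def])
  have sq_KV: "square_integrable M (\<lambda>\<omega>. K j * V j \<omega>)" for j
    by (rule square_integrable_cmult[OF sq_V])
  have S_meas [measurable]: "S \<in> borel_measurable M"
    using sq_S by measurable
  have "expectation (\<lambda>\<omega>. (S \<omega> - (\<Sum>j<n. K j * V j \<omega>))\<^sup>2) \<le>
      (LINT t|?L. expectation (\<lambda>\<omega>. (D n t \<omega>)\<^sup>2))" for n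
  proof -
    have "expectation (\<lambda>\<omega>. (S \<omega> - (\<Sum>j<n. K j * V j \<omega>))\<^sup>2) =
        expectation (\<lambda>\<omega>. (LINT t|?L. q i t * D n t \<omega>)\<^sup>2)"
      by (rule integral_cong_AE) (use X_eq[of n] in auto)
    \<comment> \<open>The first factor is the squared norm of \<open>q i\<close>, that is 1.\<close>
    also have "\<dots> \<le> (LINT t|?L. (q i t)\<^sup>2) * (LINT t|?L. expectation (\<lambda>\<omega>. (D n t \<omega>)\<^sup>2))"
      by (rule integral_square_integral_path_le[OF D sq_D int_D q])
    finally show ?thesis
      using q_orth[of i i] by (simp add: power2_eq_square)
  qed
  then have "(\<lambda>n. expectation (\<lambda>\<omega>. (S \<omega> - (\<Sum>j<n. K j * V j \<omega>))\<^sup>2)) \<longlonglongrightarrow> 0"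
    by (intro tendsto_sandwich[OF _ _ tendsto_const lim_D]) auto
  then have "sums_in_mean_square M (\<lambda>j \<omega>. K j * V j \<omega>) S"
    using sq_S sq_KV by (simp add: sums_in_mean_square_def)
  moreover have "AE \<omega> in M. spectral_char_process T q BH i \<omega> = S \<omega>"
    using G_eq' AE_space
  proof eventually_elim
    case (elim \<omega>)
    have [measurable]: "(\<lambda>t. G t \<omega>) \<in> borel_measurable ?L"
      using elim(2) by measurable
    \<comment> \<open>Joint measurability in the completion does not control each single path of
      \<open>BH\<close>; here the path is measurable because it agrees almost everywhere with that
      of \<open>G\<close>.\<close>
    have [measurable]: "(\<lambda>t. BH t \<omega>) \<in> borel_measurable ?L"
      by (rule borel_measurable_lebesgue_on_AE[where f="\<lambda>t. G t \<omega>"]) (use elim(1) in auto)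
    show ?case
      unfolding spectral_char_process_def S_def
      by (rule integral_cong_AE) (use elim(1) in auto)
  qed
  ultimately show "\<exists>S. sums_in_mean_square M
        (\<lambda>j \<omega>. spectral_char_operator T q (fbm_operator H) i j * V j \<omega>) S \<and>
      (AE \<omega> in M. spectral_char_process T q BH i \<omega> = S \<omega>)"
    unfolding K_def by blast
qed

end
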